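(* Suppose $\ker\begin{bmatrix}X_-R_-^\top\\ U_-R_-^\top\end{bmatrix}^\top=\{0\}$, let $\sigma_{(U_-,X)}^1,\dots,\sigma_{(U_-,X)}^L\in\mathbb{R}^{n\times(n+m)}$ be the vertices of the convex polytope $\Sigma_{(U_-,X)}^R$, and let $\gamma>0$. The data $(U_-,X)$ are informative for common $\mathcal{H}_2$ control with performance $\gamma$ if and only if there exist $Y\in\mathbb{R}^{n\times n}$, $W\in\mathbb{R}^{m\times n}$ and $P\in\mathbb{R}^{p\times p}$ such that $\operatorname{trace}P<\gamma$ and, with $Z:=\begin{bmatrix}Y\\ W\end{bmatrix}$, $$\begin{bmatrix}Y&0&YC^\top\\ 0&I&D^\top\\ CY&D&P\end{bmatrix}\succ0\quad\text{and}\quad\begin{bmatrix}Y&\sigma_{(U_-,X)}^iZ&I\\ \star&Y&0\\ \star&\star&\gamma I\end{bmatrix}\succ0$$ hold for all $i\in\{1,\dots,L\}$.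
   Context: Let $n,m,M,N,p\ge 1$ be integers. State data $x(0),\dots,x(N)\in\mathbb{R}^n$ and input data $u(0),\dots,u(N-1)\in\mathbb{R}^m$ are collected in $X=[x(0)\ \cdots\ x(N)]$, $X_+=[x(1)\ \cdots\ x(N)]$, $X_-=[x(0)\ \cdots\ x(N-1)]$, $U_-=[u(0)\ \cdots\ u(N-1)]$. An instrumental signal matrix $R_-\in\mathbb{R}^{M\times N}$ and bounds $C_l,C_u\in\mathbb{R}^{n\times M}$ are given. Inequalities $\le$ between matrices are entry-wise; $\succ0$ means symmetric positive definite, and $\star$ denotes blocks determined by symmetry. The data are generated by a true system $(A_0,B_0)$, i.e. $X_+=A_0X_-+B_0U_-+E_-^0$ for some unknown $E_-^0\in\mathcal{E}_R:=\{E\in\mathbb{R}^{n\times N}\mid C_l\le\tfrac{1}{\sqrt N}ER_-^\top\le C_u\}$. The (hence non-empty) set of feasible systems is $$\Sigma_{(U_-,X)}^R:=\{(A,B)\in\mathbb{R}^{n\times n}\times\mathbb{R}^{n\times m}\mid \exists E_-\in\mathcal{E}_R:\ X_+=AX_-+BU_-+E_-\}.$$ A pair $(A,B)$ is identified with $[A\ \ B]\in\mathbb{R}^{n\times(n+m)}$. Under the kernel condition of the claim, $\Sigma_{(U_-,X)}^R$ is a bounded polyhedron, so it is the convex hull of its finitely many vertices $\sigma_{(U_-,X)}^1,\dots,\sigma_{(U_-,X)}^L$. User-specified performance matrices $C\in\mathbb{R}^{p\times n}$, $D\in\mathbb{R}^{p\times n}$ are given. The data $(U_-,X)$ are informative for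 common $\mathcal{H}_2$ control with performance $\gamma$ if there exist $K\in\mathbb{R}^{m\times n}$, $Q\in\mathbb{R}^{n\times n}$ and $S\in\mathbb{R}^{p\times p}$ such that $\operatorname{trace}S<\gamma$ and for all $(A,B)\in\Sigma_{(U_-,X)}^R$: $$\begin{bmatrix}Q&Q(A+BK)&Q\\ \star&Q&0\\ \star&\star&\gamma I\end{bmatrix}\succ0,\qquad\begin{bmatrix}Q&0&C^\top\\ 0&I&D^\top\\ C&D&S\end{bmatrix}\succ0.$$ *)

theory Defs
  imports "HOL-Analysis.Analysis"
begin

text \<open>
  A real matrix with \<open>r\<close> rows and \<open>c\<close> columns has type \<open>real^'c^'r\<close>.  Block matrices
  are indexed by sum types.  The library order \<open>\<le>\<close> on \<open>real^'c^'r\<close> is entry-wise.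
\<close>

definition hcat :: "real^'a^'r \<Rightarrow> real^'b^'r \<Rightarrow> real^('a + 'b)^'r" where
  "hcat A B = (\<chi> i j. case j of Inl a \<Rightarrow> A $ i $ a | Inr b \<Rightarrow> B $ i $ b)"

definition vcat :: "real^'c^'a \<Rightarrow> real^'c^'b \<Rightarrow> real^'c^('a + 'b)" where
  "vcat A B = (\<chi> i. case i of Inl a \<Rightarrow> A $ a | Inr b \<Rightarrow> B $ b)"

definition block3 ::
  "real^'a^'a \<Rightarrow> real^'b^'a \<Rightarrow> real^'c^'a \<Rightarrow>
   real^'a^'b \<Rightarrow> real^'b^'b \<Rightarrow> real^'c^'b \<Rightarrow>
   real^'a^'c \<Rightarrow> real^'b^'c \<Rightarrow> real^'c^'c \<Rightarrow> real^('a + ('b + 'c))^('a + ('b + 'c))" where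
  "block3 A11 A12 A13 A21 A22 A23 A31 A32 A33 =
     vcat (hcat A11 (hcat A12 A13))
       (vcat (hcat A21 (hcat A22 A23))
             (hcat A31 (hcat A32 A33)))"

text \<open>The blocks below the diagonal, usually written as stars, are determined by symmetry.\<close>

definition sym_block3 ::
  "real^'a^'a \<Rightarrow> real^'b^'a \<Rightarrow> real^'c^'a \<Rightarrow> real^'b^'b \<Rightarrow> real^'c^'b \<Rightarrow> real^'c^'c \<Rightarrow>
   real^('a + ('b + 'c))^('a + ('b + 'c))" where
  "sym_block3 A11 A12 A13 A22 A23 A33 =
     block3 A11 A12 A13 (transpose A12) A22 A23 (transpose A13) (transpose A23) A33"

definition pos_def :: "real^'k^'k \<Rightarrow> bool" where
  "pos_def A \<longleftrightarrow> transpose A = A \<and> (\<forall>z. z \<noteq> 0 \<longrightarrow> z \<bullet> (A *v z) > 0)"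

definition mat_ker :: "real^'c^'r \<Rightarrow> (real^'c) set" where
  "mat_ker A = {z. A *v z = 0}"

text \<open>
  The type \<open>'N\<close> indexes the \<open>N\<close> samples; its linear order identifies it with the time
  instants \<open>0, \<dots>, N - 1\<close>.  A signal is a function on \<open>nat\<close>, of which only the values on the
  recorded horizon are used.
\<close>

definition time :: "'N::{finite,linorder} \<Rightarrow> nat" where
  "time k = card {..<k}"

definition data_minus :: "(nat \<Rightarrow> real^'a) \<Rightarrow> real^('N::{finite,linorder})^'a" where
  "data_minus s = (\<chi> i k. s (time k) $ i)"

definition data_plus :: "(nat \<Rightarrow> real^'a) \<Rightarrow> real^('N::{finite,linorder})^'a" where
  "data_plus s = (\<chi> i k. s (Suc (time k)) $ i)"

definition noise_set ::
  "real^('N::{finite,linorder})^'M \<Rightarrow> real^'M^'n \<Rightarrow> real^'M^'n \<Rightarrow> (real^('N::{finite,linorder})^'n) set" where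
  "noise_set R Cl Cu =
     {E. Cl \<le> (1 / sqrt (real CARD('N))) *\<^sub>R (E ** transpose R) \<and>
         (1 / sqrt (real CARD('N))) *\<^sub>R (E ** transpose R) \<le> Cu}"

definition feasible_systems ::
  "real^('N::{finite,linorder})^'M \<Rightarrow> real^'M^'n \<Rightarrow> real^'M^'n \<Rightarrow>
   (nat \<Rightarrow> real^'m) \<Rightarrow> (nat \<Rightarrow> real^'n) \<Rightarrow> ((real^'n^'n) \<times> (real^'m^'n)) set" where
  "feasible_systems R Cl Cu u x =
     {(A, B). \<exists>E \<in> noise_set R Cl Cu.
        data_plus x = A ** data_minus x + B ** data_minus u + E}"

definition informative_common_H2 ::
  "real^('N::{finite,linorder})^'M \<Rightarrow> real^'M^'n \<Rightarrow> real^'M^'n \<Rightarrow>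
   (nat \<Rightarrow> real^'m) \<Rightarrow> (nat \<Rightarrow> real^'n) \<Rightarrow>
   real^'n^'p \<Rightarrow> real^'n^'p \<Rightarrow> real \<Rightarrow> bool" where
  "informative_common_H2 R Cl Cu u x C D \<gamma> \<longleftrightarrow>
     (\<exists>(K :: real^'n^'m) (Q :: real^'n^'n) (S :: real^'p^'p).
        trace S < \<gamma> \<and>
        (\<forall>(A, B) \<in> feasible_systems R Cl Cu u x.
           pos_def (sym_block3 Q (Q ** (A + B ** K)) Q
                                 Q                   0
                                                     (\<gamma> *\<^sub>R mat 1)) \<and>
           pos_def (block3 Q 0       (transpose C)
                           0 (mat 1) (transpose D)
                           C D       S)))"

end

theory Submission
  imports Defs
begin

text \<open>
  Two independent ideas carry the result.

  First, for one fixed system the two pairs of matrix inequalities are the same condition in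
  different coordinates.  Substituting \<open>Y = Q\<inverse>\<close>, \<open>W = K Y\<close> and \<open>P = S\<close>, the second pair arises
  from the first by congruence with \<open>diag(Y, Y, I)\<close> and \<open>diag(Y, I, I)\<close>, and congruence with an
  invertible matrix preserves positive definiteness (lemmas \<open>H2_inequality_inverse\<close> and
  \<open>output_inequality_inverse\<close>).  The inverse exists because the leading diagonal block of a
  positive definite matrix is positive definite.

  Second, the point of the change of coordinates is that the new inequality is affine in
  \<open>V = [A B]\<close> for fixed \<open>Y\<close> and \<open>W\<close>, so it holds on a convex set of systems \<open>V\<close>
  (\<open>convex_H2_systems\<close>).  The feasible systems are the \<open>V\<close> for which \<open>V \<Phi>\<close> lies in a box, where
  \<open>\<Phi>\<close> stacks \<open>X\<^sub>- R\<^sup>T\<close> and \<open>U\<^sub>- R\<^sup>T\<close> (up to the factor \<open>1 / sqrt N\<close>).  The kernel condition makes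
  \<open>V \<mapsto> V \<Phi>\<close> injective, hence bounded below, so this set is compact and convex and by
  Krein--Milman it is the convex hull of its extreme points.  Thus the inequality holds for all
  feasible systems as soon as it holds at the vertices.  The feasible set contains the true
  system, so there is at least one system, and hence one vertex, from which the properties of
  \<open>Q\<close> or of \<open>Y\<close> can be extracted.
\<close>

section \<open>Block matrix algebra\<close>

lemma matrix_mult_add_left: "(A + B) ** C = A ** C + B ** C"
  for C :: "real^'c^'b"
  by (simp add: matrix_matrix_mult_def vec_eq_iff distrib_right sum.distrib)

lemma matrix_mult_diff_left: "(A - B) ** C = A ** C - B ** C"
  for C :: "real^'c^'b"
  by (simp add: matrix_matrix_mult_def vec_eq_iff left_diff_distrib sum_subtractf)

lemma hcat_mult_vcat: "hcat A B ** vcat C D = A ** C + B ** D"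
  by (simp add: hcat_def vcat_def matrix_matrix_mult_def vec_eq_iff sum.Plus
      flip: UNIV_Plus_UNIV)

lemma mult_hcat: "A ** hcat B C = hcat (A ** B) (A ** C)"
  by (simp add: hcat_def matrix_matrix_mult_def vec_eq_iff split: sum.split)

lemma vcat_mult: "vcat A B ** C = vcat (A ** C) (B ** C)"
  by (simp add: vcat_def matrix_matrix_mult_def vec_eq_iff split: sum.split)

lemma hcat_add: "hcat A B + hcat C D = hcat (A + C) (B + D)"
  by (simp add: hcat_def vec_eq_iff split: sum.split)

lemma transpose_hcat: "transpose (hcat A B) = vcat (transpose A) (transpose B)"
  by (simp add: hcat_def vcat_def transpose_def vec_eq_iff split: sum.split)

lemma transpose_vcat: "transpose (vcat A B) = hcat (transpose A) (transpose B)"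
  by (simp add: hcat_def vcat_def transpose_def vec_eq_iff split: sum.split)

lemma vcat_eq_iff: "vcat A B = vcat C D \<longleftrightarrow> A = C \<and> B = D"
  by (auto simp: vcat_def vec_eq_iff split: sum.splits)

lemma hcat_eq_iff: "hcat A B = hcat C D \<longleftrightarrow> A = C \<and> B = D"
  by (metis transpose_hcat transpose_transpose vcat_eq_iff)

lemma hcat_surj: "\<exists>A B. V = hcat A B"
  by (rule exI[of _ "\<chi> i a. V $ i $ Inl a"], rule exI[of _ "\<chi> i b. V $ i $ Inr b"])
     (simp add: hcat_def vec_eq_iff split: sum.split)

lemma hcat_0: "hcat 0 0 = 0"
  by (simp add: hcat_def vec_eq_iff split: sum.split)

lemma hcat_0_vcat: "hcat 0 (vcat A B) = vcat (hcat 0 A) (hcat 0 B)"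
  by (simp add: hcat_def vcat_def vec_eq_iff split: sum.split)

lemma mat_1_eq_block: "mat 1 = vcat (hcat (mat 1) 0) (hcat 0 (mat 1))"
  by (simp add: hcat_def vcat_def mat_def vec_eq_iff split: sum.split)

lemma matrix_mult_zero: "A ** 0 = 0" "0 ** B = 0"
  for A :: "real^'b^'a" and B :: "real^'c^'b"
  by (simp_all add: matrix_matrix_mult_def vec_eq_iff)

lemma transpose_zero: "transpose 0 = (0 :: real^'a^'b)"
  by (simp add: transpose_def vec_eq_iff)

definition block_diag3 ::
  "real^'a^'a \<Rightarrow> real^'b^'b \<Rightarrow> real^'c^'c \<Rightarrow> real^('a + ('b + 'c))^('a + ('b + 'c))" where
  "block_diag3 T1 T2 T3 = block3 T1 0 0 0 T2 0 0 0 T3"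

lemmas block_simps = hcat_mult_vcat mult_hcat vcat_mult hcat_add transpose_hcat transpose_vcat
  matrix_mult_zero transpose_zero

lemma transpose_block_diag3:
  "transpose (block_diag3 T1 T2 T3) = block_diag3 (transpose T1) (transpose T2) (transpose T3)"
  by (simp add: block_diag3_def block3_def hcat_def vcat_def transpose_def vec_eq_iff
      split: sum.split)

lemma block_diag3_inverse:
  assumes "T1 ** S1 = mat 1" "T2 ** S2 = mat 1" "T3 ** S3 = mat 1"
  shows "block_diag3 T1 T2 T3 ** block_diag3 S1 S2 S3 = mat 1"
  by (simp add: block_diag3_def block3_def block_simps assms mat_1_eq_block hcat_0 hcat_0_vcat)

lemma block_diag3_congruence:
  "transpose (block_diag3 T1 T2 T3) ** block3 A11 A12 A13 A21 A22 A23 A31 A32 A33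
     ** block_diag3 T1 T2 T3 =
   block3 (transpose T1 ** A11 ** T1) (transpose T1 ** A12 ** T2) (transpose T1 ** A13 ** T3)
          (transpose T2 ** A21 ** T1) (transpose T2 ** A22 ** T2) (transpose T2 ** A23 ** T3)
          (transpose T3 ** A31 ** T1) (transpose T3 ** A32 ** T2) (transpose T3 ** A33 ** T3)"
  unfolding transpose_block_diag3
  by (simp add: block_diag3_def block3_def block_simps)

section \<open>Positive definite matrices\<close>

lemma left_invertible_mult_eq_0:
  fixes U :: "real^'l^'k" and V :: "real^'k^'l"
  assumes "V ** U = mat 1" "U *v z = 0"
  shows "z = 0"
proof -
  have "z = V *v (U *v z)"
    by (simp add: matrix_vector_mul_assoc assms(1))
  then show ?thesis
    by (simp add: assms(2))
qed

lemma pos_def_congruence: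
  fixes A :: "real^'k^'k" and T :: "real^'l^'k"
  assumes A: "pos_def A" and inj: "\<And>z. T *v z = 0 \<Longrightarrow> z = 0"
  shows "pos_def (transpose T ** A ** T)"
  unfolding pos_def_def
proof (intro conjI allI impI)
  show "transpose (transpose T ** A ** T) = transpose T ** A ** T"
    using A by (simp add: pos_def_def matrix_transpose_mul matrix_mul_assoc)
next
  fix z :: "real^'l"
  assume "z \<noteq> 0"
  then have "(T *v z) \<bullet> (A *v (T *v z)) > 0"
    using A inj unfolding pos_def_def by blast
  moreover have "z \<bullet> ((transpose T ** A ** T) *v z) = (T *v z) \<bullet> (A *v (T *v z))"
    by (simp add: dot_lmul_matrix inner_commute flip: matrix_vector_mul_assoc)
       (metis dot_lmul_matrix inner_commute vector_transpose_matrix)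
  ultimately show "z \<bullet> ((transpose T ** A ** T) *v z) > 0"
    by simp
qed

lemma pos_def_congruence_iff:
  fixes A T :: "real^'k^'k"
  assumes "T ** S = mat 1"
  shows "pos_def (transpose T ** A ** T) \<longleftrightarrow> pos_def A"
proof
  have ST: "S ** T = mat 1"
    using assms matrix_left_right_inverse by blast
  show "pos_def (transpose T ** A ** T)" if "pos_def A"
    using that by (rule pos_def_congruence) (rule left_invertible_mult_eq_0[OF ST])
  have "transpose S ** (transpose T ** A ** T) ** S = (transpose (T ** S)) ** A ** (T ** S)"
    by (simp add: matrix_transpose_mul matrix_mul_assoc)
  then have "transpose S ** (transpose T ** A ** T) ** S = A"
    by (simp add: assms)
  moreover have "pos_def (transpose S ** (transpose T ** A ** T) ** S)"
    if "pos_def (transpose T ** A ** T)"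
    using that by (rule pos_def_congruence) (rule left_invertible_mult_eq_0[OF assms])
  ultimately show "pos_def A" if "pos_def (transpose T ** A ** T)"
    using that by simp
qed

text \<open>
  The leading block is the compression of the whole matrix to the first coordinates, i.e. the
  congruence with the embedding matrix \<open>[I; 0; 0]\<close>.
\<close>

lemma pos_def_block3_leading:
  assumes "pos_def (block3 A11 A12 A13 A21 A22 A23 A31 A32 A33)"
  shows "pos_def A11"
proof -
  let ?T = "vcat (mat 1) (vcat 0 0)"
  have "transpose ?T ** ?T = mat 1"
    by (simp add: block_simps)
  then have "pos_def (transpose ?T ** block3 A11 A12 A13 A21 A22 A23 A31 A32 A33 ** ?T)"
    using left_invertible_mult_eq_0 by (blast intro: pos_def_congruence[OF assms])
  then show ?thesis
    by (simp add: block3_def block_simps)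
qed

lemma pos_def_inverse_symmetric:
  fixes Q :: "real^'k^'k"
  assumes "pos_def Q"
  obtains Y where "Q ** Y = mat 1" "Y ** Q = mat 1" "transpose Y = Y"
proof -
  have "z = 0" if "Q *v z = 0" for z
    using assms that unfolding pos_def_def by force
  then obtain Y where YQ: "Y ** Q = mat 1"
    using matrix_left_invertible_ker[of Q] by blast
  then have QY: "Q ** Y = mat 1"
    using matrix_left_right_inverse by blast
  have "transpose Y ** Q = mat 1"
    using assms arg_cong[OF QY, of transpose] by (simp add: pos_def_def matrix_transpose_mul)
  then have "transpose Y = Y"
    by (metis QY matrix_mul_assoc matrix_mul_lid matrix_mul_rid)
  with QY YQ show thesis by (rule that)
qed

lemma convex_pos_def: "convex (Collect pos_def)"
proof (rule convexI)
  fix A B :: "real^'k^'k" and s t :: real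
  assume A: "A \<in> Collect pos_def" and B: "B \<in> Collect pos_def"
    and st: "0 \<le> s" "0 \<le> t" "s + t = 1"
  have "z \<bullet> ((s *\<^sub>R A + t *\<^sub>R B) *v z) > 0" if "z \<noteq> 0" for z
  proof -
    have "z \<bullet> (A *v z) > 0" "z \<bullet> (B *v z) > 0"
      using A B that by (auto simp: pos_def_def)
    moreover have "s > 0 \<or> t > 0"
      using st by linarith
    ultimately have "s * (z \<bullet> (A *v z)) + t * (z \<bullet> (B *v z)) > 0"
      using st by (auto intro: add_pos_nonneg add_nonneg_pos)
    then show ?thesis
      by (simp add: matrix_vector_mult_add_rdistrib inner_add_right
          scaleR_matrix_vector_assoc[symmetric])
  qed
  moreover have "transpose (s *\<^sub>R A + t *\<^sub>R B) = s *\<^sub>R transpose A + t *\<^sub>R transpose B"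
    by (simp add: transpose_def vec_eq_iff)
  ultimately show "s *\<^sub>R A + t *\<^sub>R B \<in> Collect pos_def"
    using A B by (simp add: pos_def_def)
qed

section \<open>The matrix inequalities in inverse coordinates\<close>

text \<open>
  The congruence with \<open>diag(Y, Y, I)\<close> strips the factor \<open>Q\<close> that makes the original inequality
  bilinear in \<open>Q\<close> and the gain: the block \<open>Q F\<close> becomes \<open>Y (Q F) Y = F Y\<close>, and with
  \<open>F = A + B K\<close> this is \<open>A Y + B W\<close> for \<open>W = K Y\<close>.
\<close>

lemma H2_inequality_inverse:
  fixes Q Y F :: "real^'n^'n"
  assumes inv: "Q ** Y = mat 1" "Y ** Q = mat 1" and sym: "transpose Y = Y"
  shows "pos_def (sym_block3 Q (Q ** F) Q Q 0 (\<gamma> *\<^sub>R mat 1)) \<longleftrightarrow>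
         pos_def (sym_block3 Y (F ** Y) (mat 1) Y 0 (\<gamma> *\<^sub>R mat 1))"
proof -
  let ?T = "block_diag3 Y Y (mat 1)"
  have Q_sym: "transpose Q = Q"
    by (metis inv matrix_mul_assoc matrix_mul_lid matrix_mul_rid matrix_transpose_mul
        sym transpose_mat)
  have YQ: "Y ** (Q ** H) = H" for H :: "real^'n^'n"
    by (simp add: matrix_mul_assoc inv)
  have "transpose ?T ** sym_block3 Q (Q ** F) Q Q 0 (\<gamma> *\<^sub>R mat 1) ** ?T =
        sym_block3 Y (F ** Y) (mat 1) Y 0 (\<gamma> *\<^sub>R mat 1)"
    unfolding sym_block3_def block_diag3_congruence
    by (simp add: sym Q_sym inv YQ matrix_mult_zero transpose_zero matrix_transpose_mul
        flip: matrix_mul_assoc)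
  moreover have "?T ** block_diag3 Q Q (mat 1) = mat 1"
    using inv by (simp add: block_diag3_inverse)
  ultimately show ?thesis
    by (metis pos_def_congruence_iff)
qed

lemma output_inequality_inverse:
  fixes Q Y :: "real^'n^'n" and C D :: "real^'n^'p"
  assumes inv: "Q ** Y = mat 1" "Y ** Q = mat 1" and sym: "transpose Y = Y"
  shows "pos_def (block3 Q 0 (transpose C) 0 (mat 1) (transpose D) C D S) \<longleftrightarrow>
         pos_def (block3 Y 0 (Y ** transpose C) 0 (mat 1) (transpose D) (C ** Y) D S)"
proof -
  let ?T = "block_diag3 Y (mat 1) (mat 1)"
  have "transpose ?T ** block3 Q 0 (transpose C) 0 (mat 1) (transpose D) C D S ** ?T =
        block3 Y 0 (Y ** transpose C) 0 (mat 1) (transpose D) (C ** Y) D S"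
    unfolding block_diag3_congruence
    by (simp add: sym inv matrix_mult_zero)
  moreover have "?T ** block_diag3 Q (mat 1) (mat 1) = mat 1"
    using inv by (simp add: block_diag3_inverse)
  ultimately show ?thesis
    by (metis pos_def_congruence_iff)
qed

text \<open>
  The remaining blocks are constants, so the map is affine but not linear in the varying block;
  hence the restriction to coefficients of sum 1.
\<close>

lemma sym_block3_convex_combination:
  assumes "s + t = (1 :: real)"
  shows "sym_block3 A11 (s *\<^sub>R F + t *\<^sub>R G) A13 A22 A23 A33 =
         s *\<^sub>R sym_block3 A11 F A13 A22 A23 A33 + t *\<^sub>R sym_block3 A11 G A13 A22 A23 A33"
proof -
  have "s * a + t * a = a" for a
    using assms by (metis distrib_right mult_1)
  then show ?thesis
    by (simp add: sym_block3_def block3_def vcat_def hcat_def transpose_def vec_eq_iff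
        split: sum.split)
qed

lemma convex_H2_systems:
  "convex {V. pos_def (sym_block3 A11 (V ** Z) A13 A22 A23 A33)}"
proof (rule convexI)
  fix V V' and s t :: real
  assume V: "V \<in> {V. pos_def (sym_block3 A11 (V ** Z) A13 A22 A23 A33)}"
    "V' \<in> {V. pos_def (sym_block3 A11 (V ** Z) A13 A22 A23 A33)}"
    and st: "0 \<le> s" "0 \<le> t" "s + t = 1"
  have "(s *\<^sub>R V + t *\<^sub>R V') ** Z = s *\<^sub>R (V ** Z) + t *\<^sub>R (V' ** Z)"
    by (simp add: matrix_mult_add_left scalar_matrix_assoc)
  then show "s *\<^sub>R V + t *\<^sub>R V' \<in> {V. pos_def (sym_block3 A11 (V ** Z) A13 A22 A23 A33)}"
    using V convexD[OF convex_pos_def _ _ st]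
    by (simp add: sym_block3_convex_combination[OF st(3)])
qed

section \<open>The polytope of feasible systems\<close>

text \<open>
  Preimages of bounded sets under an injective linear map on a finite-dimensional space are
  bounded, because such a map satisfies \<open>\<beta> \<parallel>v\<parallel> \<le> \<parallel>f v\<parallel>\<close> for some \<open>\<beta> > 0\<close>.
\<close>

lemma compact_convex_vimage_cbox:
  fixes f :: "'a::euclidean_space \<Rightarrow> 'b::euclidean_space"
  assumes f: "linear f" "inj f"
  shows "compact (f -` cbox a b)" "convex (f -` cbox a b)"
proof -
  obtain \<beta> where \<beta>: "\<beta> > 0" "\<And>v. \<beta> * norm v \<le> norm (f v)"
    using linear_inj_bounded_below_pos[OF f] by (metis mult.commute)
  obtain r where r: "\<And>w. w \<in> cbox a b \<Longrightarrow> norm w \<le> r"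
    using bounded_cbox bounded_iff by metis
  have "norm v \<le> r / \<beta>" if "v \<in> f -` cbox a b" for v
    using \<beta>(1) order_trans[OF \<beta>(2) r] that by (simp add: field_simps)
  then have "bounded (f -` cbox a b)"
    by (rule boundedI)
  moreover have "closed (f -` cbox a b)"
    using f(1) by (intro closed_vimage) (auto intro: linear_continuous_on simp: linear_linear)
  ultimately show "compact (f -` cbox a b)"
    by (simp add: compact_eq_bounded_closed)
  show "convex (f -` cbox a b)"
    using f(1) by (simp add: convex_linear_vimage)
qed

lemma linear_scaled_right_mult:
  "linear (\<lambda>V. c *\<^sub>R (V ** \<Phi>))" for \<Phi> :: "real^'c^'b"
  by (rule linearI) (simp_all add: matrix_mult_add_left scaleR_add_right mult.commute
      flip: scalar_matrix_assoc)

text \<open>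
  Row \<open>i\<close> of \<open>V \<Phi>\<close> is \<open>\<Phi>\<^sup>T\<close> applied to row \<open>i\<close> of \<open>V\<close>, so \<open>V \<Phi> = 0\<close> forces every row of \<open>V\<close> into
  the kernel of \<open>\<Phi>\<^sup>T\<close>.
\<close>

lemma inj_scaled_right_mult:
  fixes \<Phi> :: "real^'c^'b"
  assumes "mat_ker (transpose \<Phi>) = {0}" "c \<noteq> 0"
  shows "inj (\<lambda>V :: real^'b^'a. c *\<^sub>R (V ** \<Phi>))"
proof -
  have "V = 0" if "V ** \<Phi> = 0" for V :: "real^'b^'a"
  proof -
    have "transpose \<Phi> *v (V $ i) = 0" for i
    proof -
      have "transpose \<Phi> *v (V $ i) = (V ** \<Phi>) $ i"
        by (simp add: matrix_vector_mult_def matrix_matrix_mult_def transpose_def vec_eq_iff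
            mult.commute)
      then show ?thesis
        using that by simp
    qed
    then have "V $ i = 0" for i
      using assms(1) by (auto simp: mat_ker_def)
    then show ?thesis
      by (simp add: vec_eq_iff)
  qed
  with assms(2) show ?thesis
    by (simp add: linear_injective_0[OF linear_scaled_right_mult])
qed

text \<open>
  Eliminating the noise turns its two-sided bound into a box constraint on \<open>V \<Phi>\<close>: the scaled
  correlation \<open>c E R\<^sup>T\<close> of the residual is \<open>T - c V \<Phi>\<close>, so the upper noise bound gives the lower
  corner of the box and vice versa.
\<close>

lemma feasible_systems_eq_vimage:
  fixes x :: "nat \<Rightarrow> real^'n" and u :: "nat \<Rightarrow> real^'m"
    and R :: "real^('N::{finite,linorder})^'M"
  defines "c \<equiv> 1 / sqrt (real CARD('N))"
  defines "T \<equiv> c *\<^sub>R (data_plus x ** transpose R)"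
  defines "\<Phi> \<equiv> vcat (data_minus x ** transpose R) (data_minus u ** transpose R)"
  shows "(\<lambda>(A, B). hcat A B) ` feasible_systems R Cl Cu u x =
         (\<lambda>V. c *\<^sub>R (V ** \<Phi>)) -` cbox (T - Cu) (T - Cl)"
proof -
  have feasible_iff: "(A, B) \<in> feasible_systems R Cl Cu u x \<longleftrightarrow>
      c *\<^sub>R (hcat A B ** \<Phi>) \<in> cbox (T - Cu) (T - Cl)" for A B
  proof -
    \<comment> \<open>The noise realisation is the residual of the system equation.\<close>
    let ?E = "data_plus x - (A ** data_minus x + B ** data_minus u) :: real^('N::{finite,linorder})^'n"
    have "data_plus x = A ** data_minus x + B ** data_minus u + E \<longleftrightarrow> E = ?E" for E
      unfolding eq_diff_eq by (simp only: add.commute[of E] eq_commute)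
    then have "(A, B) \<in> feasible_systems R Cl Cu u x \<longleftrightarrow> ?E \<in> noise_set R Cl Cu"
      by (simp add: feasible_systems_def)
    moreover have "c *\<^sub>R (?E ** transpose R) = T - c *\<^sub>R (hcat A B ** \<Phi>)"
      by (simp add: T_def \<Phi>_def hcat_mult_vcat matrix_mul_assoc matrix_mult_add_left
          matrix_mult_diff_left algebra_simps)
    ultimately show ?thesis
      unfolding noise_set_def c_def[symmetric] interval_cbox[symmetric]
      by (auto simp: algebra_simps)
  qed
  show ?thesis
  proof (intro set_eqI)
    fix V :: "real^('n + 'm)^'n"
    obtain A B where V: "V = hcat A B"
      using hcat_surj by blast
    show "V \<in> (\<lambda>(A, B). hcat A B) ` feasible_systems R Cl Cu u x \<longleftrightarrow>
          V \<in> (\<lambda>V. c *\<^sub>R (V ** \<Phi>)) -` cbox (T - Cu) (T - Cl)"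
      using feasible_iff[of A B] by (force simp: V hcat_eq_iff)
  qed
qed

lemma feasible_systems_eq_convex_hull:
  fixes x :: "nat \<Rightarrow> real^'n" and u :: "nat \<Rightarrow> real^'m"
    and R :: "real^('N::{finite,linorder})^'M"
  defines "\<Sigma> Cl Cu \<equiv> (\<lambda>(A, B). hcat A B) ` feasible_systems R Cl Cu u x"
  assumes "mat_ker (transpose (vcat (data_minus x ** transpose R)
                                    (data_minus u ** transpose R))) = {0}"
  shows "\<Sigma> Cl Cu = convex hull {V. V extreme_point_of \<Sigma> Cl Cu}"
  unfolding \<Sigma>_def feasible_systems_eq_vimage
  by (intro Krein_Milman_Minkowski compact_convex_vimage_cbox linear_scaled_right_mult
      inj_scaled_right_mult assms) simp_all

section \<open>Reduction to the vertices\<close>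

theorem corollary25:
  fixes x :: "nat \<Rightarrow> real^'n" and u :: "nat \<Rightarrow> real^'m"
    and R :: "real^('N::{finite,linorder})^'M"
    and Cl Cu :: "real^'M^'n"
    and C D :: "real^'n^'p"
    and A0 :: "real^'n^'n" and B0 :: "real^'m^'n" and E0 :: "real^('N::{finite,linorder})^'n"
    and \<sigma> :: "nat \<Rightarrow> real^('n + 'm)^'n" and L :: nat
    and \<gamma> :: real
  assumes noise: "E0 \<in> noise_set R Cl Cu"
    and true_system: "data_plus x = A0 ** data_minus x + B0 ** data_minus u + E0"
    and kernel: "mat_ker (transpose (vcat (data_minus x ** transpose R)
                                          (data_minus u ** transpose R))) = {0}"
    and vertices: "\<sigma> ` {1..L} =
      {V. V extreme_point_of ((\<lambda>(A, B). hcat A B) ` feasible_systems R Cl Cu u x)}"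
    and gamma_pos: "\<gamma> > 0"
  shows "informative_common_H2 R Cl Cu u x C D \<gamma> \<longleftrightarrow>
    (\<exists>(Y :: real^'n^'n) (W :: real^'n^'m) (P :: real^'p^'p).
       trace P < \<gamma> \<and>
       (let Z = vcat Y W in
        \<forall>i \<in> {1..L}.
          pos_def (block3 Y        0       (Y ** transpose C)
                          0        (mat 1) (transpose D)
                          (C ** Y) D       P) \<and>
          pos_def (sym_block3 Y (\<sigma> i ** Z) (mat 1)
                                Y          0
                                           (\<gamma> *\<^sub>R mat 1))))"
proof -
  let ?\<Sigma> = "(\<lambda>(A, B). hcat A B) ` feasible_systems R Cl Cu u x"
  have hull: "?\<Sigma> = convex hull (\<sigma> ` {1..L})"
    unfolding vertices by (rule feasible_systems_eq_convex_hull[OF kernel])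
  \<comment> \<open>Without a feasible system and a vertex, both quantified conditions would hold vacuously and
    say nothing about \<open>Q\<close> or \<open>Y\<close>.\<close>
  have true_feasible: "(A0, B0) \<in> feasible_systems R Cl Cu u x"
    using noise true_system by (auto simp: feasible_systems_def)
  then have "\<sigma> ` {1..L} \<noteq> {}"
    using hull by force
  then have one_vertex: "1 \<in> {1..L}"
    by auto
  show ?thesis
  proof
    assume "informative_common_H2 R Cl Cu u x C D \<gamma>"
    then obtain K :: "real^'n^'m" and Q :: "real^'n^'n" and S :: "real^'p^'p"
      where trace: "trace S < \<gamma>"
      and H2: "\<And>A B. (A, B) \<in> feasible_systems R Cl Cu u x \<Longrightarrow>
        pos_def (sym_block3 Q (Q ** (A + B ** K)) Q Q 0 (\<gamma> *\<^sub>R mat 1 :: real^'n^'n))"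
      and out: "\<And>A B. (A, B) \<in> feasible_systems R Cl Cu u x \<Longrightarrow>
        pos_def (block3 Q 0 (transpose C) 0 (mat 1) (transpose D) C D S)"
      unfolding informative_common_H2_def by fast
    have "pos_def Q"
      using pos_def_block3_leading[OF out[OF true_feasible]] .
    then obtain Y where Y: "Q ** Y = mat 1" "Y ** Q = mat 1" "transpose Y = Y"
      by (rule pos_def_inverse_symmetric)
    have "pos_def (sym_block3 Y (\<sigma> i ** vcat Y (K ** Y)) (mat 1) Y 0 (\<gamma> *\<^sub>R mat 1))"
      if "i \<in> {1..L}" for i
    proof -
      have "\<sigma> i \<in> ?\<Sigma>"
        using that hull hull_inc by (metis imageI)
      then obtain A B where AB: "(A, B) \<in> feasible_systems R Cl Cu u x" "\<sigma> i = hcat A B"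
        by auto
      have "\<sigma> i ** vcat Y (K ** Y) = (A + B ** K) ** Y"
        by (simp add: AB(2) hcat_mult_vcat matrix_mult_add_left matrix_mul_assoc)
      then show ?thesis
        using H2[OF AB(1)] H2_inequality_inverse[OF Y] by simp
    qed
    moreover have "pos_def (block3 Y 0 (Y ** transpose C) 0 (mat 1) (transpose D) (C ** Y) D S)"
      using out[OF true_feasible] output_inequality_inverse[OF Y] by blast
    ultimately show "\<exists>(Y :: real^'n^'n) (W :: real^'n^'m) (P :: real^'p^'p).
       trace P < \<gamma> \<and>
       (let Z = vcat Y W in
        \<forall>i \<in> {1..L}.
          pos_def (block3 Y 0 (Y ** transpose C) 0 (mat 1) (transpose D) (C ** Y) D P) \<and>
          pos_def (sym_block3 Y (\<sigma> i ** Z) (mat 1) Y 0 (\<gamma> *\<^sub>R mat 1)))"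
      using trace unfolding Let_def by blast
  next
    assume "\<exists>(Y :: real^'n^'n) (W :: real^'n^'m) (P :: real^'p^'p).
       trace P < \<gamma> \<and>
       (let Z = vcat Y W in
        \<forall>i \<in> {1..L}.
          pos_def (block3 Y 0 (Y ** transpose C) 0 (mat 1) (transpose D) (C ** Y) D P) \<and>
          pos_def (sym_block3 Y (\<sigma> i ** Z) (mat 1) Y 0 (\<gamma> *\<^sub>R mat 1)))"
    then obtain Y :: "real^'n^'n" and W :: "real^'n^'m" and P :: "real^'p^'p"
      where trace: "trace P < \<gamma>"
      and out: "\<And>i. i \<in> {1..L} \<Longrightarrow>
        pos_def (block3 Y 0 (Y ** transpose C) 0 (mat 1) (transpose D) (C ** Y) D P)"
      and H2: "\<And>i. i \<in> {1..L} \<Longrightarrow>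
        pos_def (sym_block3 Y (\<sigma> i ** vcat Y W) (mat 1) Y 0 (\<gamma> *\<^sub>R mat 1 :: real^'n^'n))"
      unfolding Let_def by blast
    have Y_pos: "pos_def Y"
      using pos_def_block3_leading[OF out[OF one_vertex]] .
    then obtain Q where Q: "Y ** Q = mat 1" "Q ** Y = mat 1"
      by (rule pos_def_inverse_symmetric)
    have Y: "Q ** Y = mat 1" "Y ** Q = mat 1" "transpose Y = Y"
      using Q Y_pos by (simp_all add: pos_def_def)
    have hull_subset:
      "?\<Sigma> \<subseteq> {V. pos_def (sym_block3 Y (V ** vcat Y W) (mat 1) Y 0 (\<gamma> *\<^sub>R mat 1 :: real^'n^'n))}"
      unfolding hull using H2 by (intro hull_minimal convex_H2_systems) blast
    have "pos_def (sym_block3 Q (Q ** (A + B ** (W ** Q))) Q Q 0 (\<gamma> *\<^sub>R mat 1 :: real^'n^'n))"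
      if "(A, B) \<in> feasible_systems R Cl Cu u x" for A B
    proof -
      have "(A + B ** (W ** Q)) ** Y = A ** Y + B ** (W ** (Q ** Y))"
        by (simp add: matrix_mult_add_left matrix_mul_assoc)
      then have "(A + B ** (W ** Q)) ** Y = hcat A B ** vcat Y W"
        by (simp add: hcat_mult_vcat Q)
      moreover have "hcat A B \<in> ?\<Sigma>"
        using that by force
      ultimately show ?thesis
        using hull_subset H2_inequality_inverse[OF Y] by auto
    qed
    moreover have "pos_def (block3 Q 0 (transpose C) 0 (mat 1) (transpose D) C D P)"
      using out[OF one_vertex] output_inequality_inverse[OF Y] by blast
    ultimately show "informative_common_H2 R Cl Cu u x C D \<gamma>"
      unfolding informative_common_H2_def using trace by blast
  qed
qed

end
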